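(* Consider a cooperative Markov game, a directed acyclic graph $\mathcal G$ on the agents, and the tabular softmax Bayesian network (BN) joint policy $\pi_\theta=(\pi^1_{\theta^1},\dots,\pi^N_{\theta^N})$ associated with $\mathcal G$ (all as defined in the context). Then for every agent $i\in\mathcal N$, state $s\in\mathcal S$, parent actions $a^{\mathcal P^i}\in\times_{j\in\mathcal P^i}\mathcal A^j$ and local action $a^i\in\mathcal A^i$, $$\frac{\partial V_\theta(\mu)}{\partial \theta^i_{s,a^{\mathcal P^i},a^i}}=\frac{1}{1-\gamma}\,d_\mu^{\pi_\theta}(s,a^{\mathcal P^i})\,\pi^i_{\theta^i}(a^i\mid s,a^{\mathcal P^i})\,A^i_\theta(s,a^{\mathcal P^i},a^i),$$ where $d_\mu^{\pi_\theta}(s,a^{\mathcal P^i}):=d_\mu^{\pi_\theta}(s)\sum_{a^{-\mathcal P^i}}\pi_\theta(a^{-\mathcal P^i},a^{\mathcal P^i}\mid s)$ and $A^i_\theta(s,a^{\mathcal P^i},a^i):=Q_\theta(s,a^{\mathcal P^i_+})-Q_\theta(s,a^{\mathcal P^i})$, with $a^{\mathcal P^i_+}=(a^{\mathcal P^i},a^i)$.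
   Context: Cooperative Markov game $\langle\mathcal N,\mathcal S,\mathcal A,P,r,\mu\rangle$: agents $\mathcal N=\{1,\dots,N\}$; finite state space $\mathcal S$; finite joint action space $\mathcal A=\mathcal A^1\times\cdots\times\mathcal A^N$; transition function $P:\mathcal S\times\mathcal A\to\Delta(\mathcal S)$; shared reward $r:\mathcal S\times\mathcal A\to\mathbb R$; initial state distribution $\mu\in\Delta(\mathcal S)$; discount $\gamma\in[0,1)$. Here $\Delta(X)$ is the set of probability distributions on $X$. For a joint policy $\pi:\mathcal S\to\Delta(\mathcal A)$, $V_\pi(s)=\mathbb E_\pi[\sum_{t\ge0}\gamma^t r(s_t,a_t)\mid s_0=s]$, $Q_\pi(s,a)=\mathbb E_\pi[\sum_{t\ge0}\gamma^t r(s_t,a_t)\mid s_0=s,a_0=a]$, $V_\pi(\mu)=\mathbb E_{s\sim\mu}[V_\pi(s)]$. The (unnormalized) discounted state visitation measure is $d^\pi_\mu(s)=\mathbb E_{s_0\sim\mu}\big[\sum_{t\ge0}\gamma^t\Pr^\pi(s_t=s\mid s_0)\big]$, where $\Pr^\pi(s_t=s\mid s_0)$ is the probability that $s_t=s$ when starting at $s_0$ and following $\pi$. BN policy: $\mathcal G=(\mathcal N,\mathcal E)$ is a directed acyclic graph, $\mathcal P^i=\{j:(i,j)\in\mathcal E\}$ is the set of parents of agent $i$, $\mathcal P^i_+=\mathcal P^i\cup\{i\}$. Local policies are $\pi^i:\mathcal S\times(\times_{j\in\mathcal P^i}\mathcal A^j)\to\Delta(\mathcal A^i)$ and the joint policy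 is $\pi(a\mid s)=\prod_{i\in\mathcal N}\pi^i(a^i\mid s,a^{\mathcal P^i})$. Tabular softmax parameterization: $\theta^i=\{\theta^i_{s,a^{\mathcal P^i},a^i}\in\mathbb R\}$, $\pi^i_{\theta^i}(a^i\mid s,a^{\mathcal P^i})=\exp(\theta^i_{s,a^{\mathcal P^i},a^i})/\sum_{b\in\mathcal A^i}\exp(\theta^i_{s,a^{\mathcal P^i},b})$; $\theta=(\theta^1,\dots,\theta^N)$; $V_\theta:=V_{\pi_\theta}$, $Q_\theta:=Q_{\pi_\theta}$. For $\mathcal M\subseteq\mathcal N$ with complement $-\mathcal M$, write $a=(a^{\mathcal M},a^{-\mathcal M})$; $\pi^{\mathcal M}(a^{\mathcal M}\mid s,a^{-\mathcal M})=\pi(a^{\mathcal M},a^{-\mathcal M}\mid s)/\sum_{\bar a^{\mathcal M}}\pi(\bar a^{\mathcal M},a^{-\mathcal M}\mid s)$; and $Q_\pi(s,a^{\mathcal M})=\mathbb E_{a^{-\mathcal M}\sim\pi^{-\mathcal M}(\cdot\mid s,a^{\mathcal M})}[Q_\pi(s,a^{\mathcal M},a^{-\mathcal M})]$.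
   Formalization: With the prefactor 1/(1−γ), the visitation measure d is taken normalized, (1−γ) times the discounted sum; with the unnormalized d of the context the formula counts 1/(1−γ) twice and fails already for one state and one agent. *)

theory Defs
  imports "HOL-Probability.Probability"
begin

section \<open>Cooperative Markov games\<close>

text \<open>The action sets of the agents are subsets of a common type. A joint action of a set \<open>K\<close> of
  agents is an element of \<open>Pi\<^sub>E K (actions G)\<close>, that is, a function which is \<open>undefined\<close> outside \<open>K\<close>.
  The values of \<open>trans\<close> and \<open>reward\<close> at functions that are not joint actions of all agents
  are irrelevant.\<close>

record ('s, 'a) markov_game =
  num_agents :: nat
  actions :: "nat \<Rightarrow> 'a set"
  trans :: "'s \<Rightarrow> (nat \<Rightarrow> 'a) \<Rightarrow> 's pmf"
  reward :: "'s \<Rightarrow> (nat \<Rightarrow> 'a) \<Rightarrow> real"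
  init_dist :: "'s pmf"
  discount :: real

definition agents :: "('s, 'a) markov_game \<Rightarrow> nat set" where
  "agents G = {1..num_agents G}"

abbreviation joint_actions :: "('s, 'a) markov_game \<Rightarrow> nat set \<Rightarrow> (nat \<Rightarrow> 'a) set" where
  "joint_actions G K \<equiv> Pi\<^sub>E K (actions G)"

definition is_markov_game :: "('s::finite, 'a) markov_game \<Rightarrow> bool" where
  "is_markov_game G \<longleftrightarrow>
     (\<forall>i\<in>agents G. finite (actions G i) \<and> actions G i \<noteq> {}) \<and>
     0 \<le> discount G \<and> discount G < 1"


section \<open>Trajectories, values and visitation measure\<close>

type_synonym ('s, 'a) policy = "'s \<Rightarrow> (nat \<Rightarrow> 'a) pmf"

text \<open>The law of the state-action pair at time \<open>n\<close> given the pairs at times \<open>< n\<close>, where \<open>\<iota>\<close> is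
  the law of the pair at time \<open>0\<close>; the law of the whole trajectory comes from the
  Ionescu-Tulcea theorem.\<close>

definition step_kernel ::
  "('s, 'a) markov_game \<Rightarrow> ('s, 'a) policy \<Rightarrow> ('s \<times> (nat \<Rightarrow> 'a)) pmf \<Rightarrow>
   nat \<Rightarrow> (nat \<Rightarrow> 's \<times> (nat \<Rightarrow> 'a)) \<Rightarrow> ('s \<times> (nat \<Rightarrow> 'a)) measure" where
  "step_kernel G \<pi> \<iota> n \<omega> = measure_pmf
     (case n of 0 \<Rightarrow> \<iota>
      | Suc m \<Rightarrow> trans G (fst (\<omega> m)) (snd (\<omega> m)) \<bind> (\<lambda>s. map_pmf (Pair s) (\<pi> s)))"

lemma Ionescu_Tulcea_step_kernel:
  "Ionescu_Tulcea (step_kernel G \<pi> \<iota>) (\<lambda>_. count_space UNIV)"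
proof (rule Ionescu_Tulcea.intro)
  show "step_kernel G \<pi> \<iota> i \<in> PiM {0..<i} (\<lambda>_. count_space UNIV) \<rightarrow>\<^sub>M subprob_algebra (count_space UNIV)"
    for i
  proof (cases i)
    case 0
    have "step_kernel G \<pi> \<iota> 0 = (\<lambda>_. measure_pmf \<iota>)"
      by (simp add: step_kernel_def fun_eq_iff)
    then show ?thesis using 0 by (simp add: measure_pmf_in_subprob_algebra)
  next
    case (Suc m)
    have "(\<lambda>\<omega>. \<omega> m) \<in> PiM {0..<i} (\<lambda>_. count_space UNIV) \<rightarrow>\<^sub>M count_space UNIV"
      using Suc by (intro measurable_component_singleton) auto
    moreover have "(\<lambda>x. measure_pmf (trans G (fst x) (snd x) \<bind> (\<lambda>s. map_pmf (Pair s) (\<pi> s))))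
        \<in> count_space UNIV \<rightarrow>\<^sub>M subprob_algebra (count_space UNIV)"
      by (simp add: measure_pmf_in_subprob_algebra)
    ultimately show ?thesis
      unfolding step_kernel_def Suc nat.case using measurable_compose by blast
  qed
qed (simp add: step_kernel_def measure_pmf.prob_space_axioms)

definition trajectory ::
  "('s, 'a) markov_game \<Rightarrow> ('s, 'a) policy \<Rightarrow> ('s \<times> (nat \<Rightarrow> 'a)) pmf \<Rightarrow>
   (nat \<Rightarrow> 's \<times> (nat \<Rightarrow> 'a)) measure" where
  "trajectory G \<pi> \<iota> = projective_family.lim UNIV
     (Ionescu_Tulcea.CI (step_kernel G \<pi> \<iota>) (\<lambda>_. count_space UNIV)) (\<lambda>_. count_space UNIV)"

definition start_state :: "('s, 'a) policy \<Rightarrow> 's \<Rightarrow> ('s \<times> (nat \<Rightarrow> 'a)) pmf" where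
  "start_state \<pi> s = map_pmf (Pair s) (\<pi> s)"

definition return_of :: "('s, 'a) markov_game \<Rightarrow> (nat \<Rightarrow> 's \<times> (nat \<Rightarrow> 'a)) \<Rightarrow> real" where
  "return_of G \<omega> = (\<Sum>t. discount G ^ t * reward G (fst (\<omega> t)) (snd (\<omega> t)))"

definition state_value :: "('s, 'a) markov_game \<Rightarrow> ('s, 'a) policy \<Rightarrow> 's \<Rightarrow> real" where
  "state_value G \<pi> s = (LINT \<omega> | trajectory G \<pi> (start_state \<pi> s). return_of G \<omega>)"

definition action_value :: "('s, 'a) markov_game \<Rightarrow> ('s, 'a) policy \<Rightarrow> 's \<Rightarrow> (nat \<Rightarrow> 'a) \<Rightarrow> real" where
  "action_value G \<pi> s a = (LINT \<omega> | trajectory G \<pi> (return_pmf (s, a)). return_of G \<omega>)"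

definition game_value :: "('s, 'a) markov_game \<Rightarrow> ('s, 'a) policy \<Rightarrow> real" where
  "game_value G \<pi> = measure_pmf.expectation (init_dist G) (state_value G \<pi>)"

definition visitation :: "('s, 'a) markov_game \<Rightarrow> ('s, 'a) policy \<Rightarrow> 's \<Rightarrow> real" where
  "visitation G \<pi> s = measure_pmf.expectation (init_dist G) (\<lambda>s0.
     \<Sum>t. discount G ^ t *
       measure (trajectory G \<pi> (start_state \<pi> s0))
         {\<omega> \<in> space (trajectory G \<pi> (start_state \<pi> s0)). fst (\<omega> t) = s})"

text \<open>Normalization: \<open>visitation\<close> has total mass \<open>1 / (1 - \<gamma>)\<close>. A policy gradient formula with the
  prefactor \<open>1 / (1 - \<gamma>)\<close> is correct for the visitation distribution of total mass \<open>1\<close>; with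
  \<open>visitation\<close> itself the factor would be counted twice (already for one state and one agent).\<close>

definition visitation_distr :: "('s, 'a) markov_game \<Rightarrow> ('s, 'a) policy \<Rightarrow> 's \<Rightarrow> real" where
  "visitation_distr G \<pi> s = (1 - discount G) * visitation G \<pi> s"


section \<open>Conditioning on the actions of some agents\<close>

text \<open>\<open>merge K L (x, y)\<close> is the joint action that agrees with \<open>x\<close> on \<open>K\<close> and with \<open>y\<close> on \<open>L\<close>.\<close>

definition cond_policy ::
  "('s, 'a) markov_game \<Rightarrow> ('s, 'a) policy \<Rightarrow> nat set \<Rightarrow> 's \<Rightarrow> (nat \<Rightarrow> 'a) \<Rightarrow> (nat \<Rightarrow> 'a) \<Rightarrow> real" where
  "cond_policy G \<pi> K s x y =
     pmf (\<pi> s) (merge K (agents G - K) (x, y)) /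
     (\<Sum>x'\<in>joint_actions G K. pmf (\<pi> s) (merge K (agents G - K) (x', y)))"

definition partial_action_value ::
  "('s, 'a) markov_game \<Rightarrow> ('s, 'a) policy \<Rightarrow> nat set \<Rightarrow> 's \<Rightarrow> (nat \<Rightarrow> 'a) \<Rightarrow> real" where
  "partial_action_value G \<pi> K s x =
     (\<Sum>y\<in>joint_actions G (agents G - K).
        cond_policy G \<pi> (agents G - K) s y x * action_value G \<pi> s (merge K (agents G - K) (x, y)))"

definition partial_visitation_distr ::
  "('s, 'a) markov_game \<Rightarrow> ('s, 'a) policy \<Rightarrow> nat set \<Rightarrow> 's \<Rightarrow> (nat \<Rightarrow> 'a) \<Rightarrow> real" where
  "partial_visitation_distr G \<pi> K s x = visitation_distr G \<pi> s *
     (\<Sum>y\<in>joint_actions G (agents G - K). pmf (\<pi> s) (merge K (agents G - K) (x, y)))"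


section \<open>Bayesian network policies\<close>

text \<open>An edge \<open>(i, j)\<close> means that \<open>j\<close> is a parent of \<open>i\<close>.\<close>

definition is_dag :: "'v set \<Rightarrow> ('v \<times> 'v) set \<Rightarrow> bool" where
  "is_dag V E \<longleftrightarrow> E \<subseteq> V \<times> V \<and> acyclic E"

definition parents :: "('v \<times> 'v) set \<Rightarrow> 'v \<Rightarrow> 'v set" where
  "parents E i = {j. (i, j) \<in> E}"

text \<open>The third argument of a family of local policies is the joint action of the parents.\<close>

definition bn_policy ::
  "('s, 'a) markov_game \<Rightarrow> (nat \<times> nat) set \<Rightarrow> (nat \<Rightarrow> 's \<Rightarrow> (nat \<Rightarrow> 'a) \<Rightarrow> 'a pmf) \<Rightarrow> ('s, 'a) policy" where
  "bn_policy G E \<rho> s = embed_pmf (\<lambda>a. if a \<in> joint_actions G (agents G)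
     then \<Prod>i\<in>agents G. pmf (\<rho> i s (restrict a (parents E i))) (a i) else 0)"

type_synonym ('s, 'a) params = "nat \<times> 's \<times> (nat \<Rightarrow> 'a) \<times> 'a \<Rightarrow> real"

definition softmax_policy ::
  "('s, 'a) markov_game \<Rightarrow> ('s, 'a) params \<Rightarrow> nat \<Rightarrow> 's \<Rightarrow> (nat \<Rightarrow> 'a) \<Rightarrow> 'a pmf" where
  "softmax_policy G \<theta> i s p = embed_pmf (\<lambda>b. if b \<in> actions G i
     then exp (\<theta> (i, s, p, b)) / (\<Sum>c\<in>actions G i. exp (\<theta> (i, s, p, c))) else 0)"

definition softmax_bn_policy ::
  "('s, 'a) markov_game \<Rightarrow> (nat \<times> nat) set \<Rightarrow> ('s, 'a) params \<Rightarrow> ('s, 'a) policy" where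
  "softmax_bn_policy G E \<theta> = bn_policy G E (softmax_policy G \<theta>)"

definition local_advantage ::
  "('s, 'a) markov_game \<Rightarrow> (nat \<times> nat) set \<Rightarrow> ('s, 'a) policy \<Rightarrow> nat \<Rightarrow> 's \<Rightarrow> (nat \<Rightarrow> 'a) \<Rightarrow> 'a \<Rightarrow> real" where
  "local_advantage G E \<pi> i s p b =
     partial_action_value G \<pi> (insert i (parents E i)) s (p(i := b)) -
     partial_action_value G \<pi> (parents E i) s p"


text \<open>Both uses of \<open>embed_pmf\<close> are legitimate: the weights sum to \<open>1\<close>.\<close>

lemma pmf_embed_pmf_finite:
  assumes "finite A" "\<And>x. x \<in> A \<Longrightarrow> 0 \<le> f x" "sum f A = 1"
  shows "pmf (embed_pmf (\<lambda>x. if x \<in> A then f x else 0)) x = (if x \<in> A then f x else (0::real))"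
proof (rule pmf_embed_pmf)
  have "(\<integral>\<^sup>+x. ennreal (if x \<in> A then f x else 0) \<partial>count_space UNIV)
      = (\<Sum>x\<in>A. ennreal (if x \<in> A then f x else 0))"
    using assms(1) by (intro nn_integral_count_space') auto
  also have "\<dots> = ennreal (sum f A)"
    using assms by (subst sum_ennreal[symmetric]) auto
  finally show "(\<integral>\<^sup>+x. ennreal (if x \<in> A then f x else 0) \<partial>count_space UNIV) = 1"
    using assms by simp
qed (use assms in auto)

lemma pmf_softmax_policy:
  assumes "is_markov_game G" "i \<in> agents G"
  shows "pmf (softmax_policy G \<theta> i s p) b = (if b \<in> actions G i
     then exp (\<theta> (i, s, p, b)) / (\<Sum>c\<in>actions G i. exp (\<theta> (i, s, p, c))) else 0)"
proof -
  have A: "finite (actions G i)" "actions G i \<noteq> {}"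
    using assms by (auto simp: is_markov_game_def)
  then have pos: "(\<Sum>c\<in>actions G i. exp (\<theta> (i, s, p, c))) > 0"
    by (intro sum_pos) auto
  show ?thesis
    unfolding softmax_policy_def
    by (rule pmf_embed_pmf_finite)
       (use A pos in \<open>auto simp: sum_divide_distrib[symmetric]\<close>)
qed

lemma sum_bn_weights:
  fixes f :: "nat \<Rightarrow> (nat \<Rightarrow> 'a) \<Rightarrow> 'a \<Rightarrow> real" and A :: "nat \<Rightarrow> 'a set"
  assumes "finite E" "acyclic E" "finite K" "\<And>i. i \<in> K \<Longrightarrow> parents E i \<subseteq> K"
    and "\<And>i. i \<in> K \<Longrightarrow> finite (A i)" "\<And>i x. i \<in> K \<Longrightarrow> (\<Sum>b\<in>A i. f i x b) = 1"
  shows "(\<Sum>a\<in>Pi\<^sub>E K A. \<Prod>i\<in>K. f i (restrict a (parents E i)) (a i)) = 1"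
  using assms(3-)
proof (induction "card K" arbitrary: K)
  case 0
  then show ?case by simp
next
  case (Suc n)
  have "wf E" using assms finite_acyclic_wf by blast
  moreover have "K \<noteq> {}" using Suc.hyps by auto
  ultimately obtain i where i: "i \<in> K" "\<And>k. (k, i) \<in> E \<Longrightarrow> k \<notin> K"
    using wfE_min by (metis ex_in_conv)
  define L where "L = K - {i}"
  have K: "K = insert i L" "i \<notin> L" "finite L" using i Suc.prems by (auto simp: L_def)
  have par: "i \<notin> parents E k" if "k \<in> K" for k
    using i that by (auto simp: parents_def)
  have IH: "(\<Sum>a\<in>Pi\<^sub>E L A. \<Prod>k\<in>L. f k (restrict a (parents E k)) (a k)) = 1"
  proof (rule Suc.hyps(1))
    show "n = card L" using Suc.hyps(2) K by simp
    show "parents E k \<subseteq> L" if "k \<in> L" for k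
      using Suc.prems(2)[of k] par[of k] that K by auto
  qed (use Suc.prems K in auto)
  have "(\<Sum>a\<in>Pi\<^sub>E K A. \<Prod>k\<in>K. f k (restrict a (parents E k)) (a k)) =
    (\<Sum>(b, a)\<in>A i \<times> Pi\<^sub>E L A. \<Prod>k\<in>K. f k (restrict (a(i := b)) (parents E k)) ((a(i := b)) k))"
    unfolding K(1) PiE_insert_eq using K(2)
    by (subst sum.reindex) (auto intro: inj_combinator simp: case_prod_beta)
  also have "\<dots> = (\<Sum>(b, a)\<in>A i \<times> Pi\<^sub>E L A.
      f i (restrict a (parents E i)) b * (\<Prod>k\<in>L. f k (restrict a (parents E k)) (a k)))"
  proof (intro sum.cong refl, clarify)
    fix b :: 'a and a :: "nat \<Rightarrow> 'a"
    have r: "restrict (a(i := b)) (parents E k) = restrict a (parents E k)" if "k \<in> K" for k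
      using par[OF that] by (auto simp: restrict_def)
    have "(\<Prod>k\<in>L. f k (restrict (a(i := b)) (parents E k)) ((a(i := b)) k)) =
      (\<Prod>k\<in>L. f k (restrict a (parents E k)) (a k))"
      using r K by (intro prod.cong refl) auto
    then show "(\<Prod>k\<in>K. f k (restrict (a(i := b)) (parents E k)) ((a(i := b)) k)) =
      f i (restrict a (parents E i)) b * (\<Prod>k\<in>L. f k (restrict a (parents E k)) (a k))"
      using r[OF i(1)] K by (simp add: prod.insert del: fun_upd_apply) simp
  qed
  also have "\<dots> = (\<Sum>a\<in>Pi\<^sub>E L A. \<Sum>b\<in>A i.
      f i (restrict a (parents E i)) b * (\<Prod>k\<in>L. f k (restrict a (parents E k)) (a k)))"
    by (subst sum.cartesian_product[symmetric], subst sum.swap) simp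
  also have "\<dots> = 1"
    using Suc.prems(4)[OF i(1)] IH by (simp add: sum_distrib_right[symmetric])
  finally show ?case .
qed

lemma pmf_softmax_bn_policy:
  assumes "is_markov_game G" "is_dag (agents G) E"
  shows "pmf (softmax_bn_policy G E \<theta> s) a = (if a \<in> joint_actions G (agents G)
     then \<Prod>i\<in>agents G. pmf (softmax_policy G \<theta> i s (restrict a (parents E i))) (a i) else 0)"
  unfolding softmax_bn_policy_def bn_policy_def
proof (rule pmf_embed_pmf_finite)
  have A: "finite (actions G i)" "actions G i \<noteq> {}" if "i \<in> agents G" for i
    using assms that by (auto simp: is_markov_game_def)
  have fin: "finite (agents G)" by (simp add: agents_def)
  show "finite (joint_actions G (agents G))"
    using A fin by (intro finite_PiE) auto
  have "finite E"
    using assms(2) fin by (auto simp: is_dag_def intro: finite_subset)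
  then show "(\<Sum>a\<in>joint_actions G (agents G).
      \<Prod>i\<in>agents G. pmf (softmax_policy G \<theta> i s (restrict a (parents E i))) (a i)) = 1"
  proof (rule sum_bn_weights)
    show "(\<Sum>b\<in>actions G i. pmf (softmax_policy G \<theta> i s x) b) = 1" if "i \<in> agents G" for i x
      using A[OF that] pmf_softmax_policy[OF assms(1) that, of \<theta> s x]
      by (intro sum_pmf_eq_1) (auto simp: set_pmf_iff split: if_splits)
  qed (use assms fin A in \<open>auto simp: is_dag_def parents_def\<close>)
qed (auto intro: prod_nonneg)

end

theory Submission
  imports Defs
begin

text \<open>The marginals of the trajectory measure are iterated \<open>pmf\<close> binds supported in a finite set, so
  values and visitation are discounted sums of finite expectations. Telescoping the Bellman equation
  along trajectories of \<open>\<pi>'\<close> gives the performance difference lemma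
  \<open>V\<^sub>\<pi>\<^sub>'(\<mu>) - V\<^sub>\<pi>(\<mu>) = \<Sum>\<^sub>s d\<^sub>\<pi>\<^sub>'(s) \<Sum>\<^sub>a (\<pi>'(a|s) - \<pi>(a|s)) Q\<^sub>\<pi>(s, a)\<close>, valid for every reward function.
  For an indicator reward it shows that \<open>d\<^sub>\<pi>\<close> is continuous in \<open>\<pi>\<close>; for the reward of the game,
  dividing by the parameter increment and passing to the limit then yields the policy gradient
  \<open>\<Sum>\<^sub>s d\<^sub>\<pi>(s) \<Sum>\<^sub>a \<partial>\<pi>(a|s) Q\<^sub>\<pi>(s, a)\<close>. For the softmax network, \<open>\<partial>\<pi>(a|s)\<close> vanishes unless \<open>a\<close> restricts to
  \<open>p\<close> on the parents of \<open>i\<close>, and then equals \<open>\<pi>(a|s) (1[a\<^sub>i = b] - \<pi>\<^sup>i(b|s, p))\<close>. Since \<open>\<Sum>\<^sub>a \<partial>\<pi>(a|s) = 0\<close>,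
  the probability of \<open>(p, b)\<close> is \<open>\<pi>\<^sup>i(b|s, p)\<close> times that of \<open>p\<close>, which turns the two conditional
  action values of the advantage into the two parts of this sum.\<close>

section \<open>Marginals of the trajectory measure\<close>

text \<open>The time-\<open>t\<close> marginal of \<open>trajectory\<close>, as
  \<open>distr_trajectory\<close> confirms. Working inside \<open>pmf\<close> reduces expectations
  to finite sums once supports are finite.\<close>

primrec pair_law ::
  "('s, 'a) markov_game \<Rightarrow> ('s, 'a) policy \<Rightarrow> ('s \<times> (nat \<Rightarrow> 'a)) pmf \<Rightarrow> nat \<Rightarrow> ('s \<times> (nat \<Rightarrow> 'a)) pmf"
where
  "pair_law G \<pi> \<iota> 0 = \<iota>"
| "pair_law G \<pi> \<iota> (Suc t) =
     pair_law G \<pi> \<iota> t \<bind> (\<lambda>x. trans G (fst x) (snd x) \<bind> start_state \<pi>)"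

lemma step_kernel_simps:
  "step_kernel G \<pi> \<iota> 0 \<omega> = measure_pmf \<iota>"
  "step_kernel G \<pi> \<iota> (Suc m) \<omega> = measure_pmf (trans G (fst (\<omega> m)) (snd (\<omega> m)) \<bind> start_state \<pi>)"
  by (simp_all add: step_kernel_def start_state_def[abs_def])

text \<open>Integrating out the last coordinate leaves the kernel, which depends only on the
  previous coordinate, so induction on \<open>t\<close> with arbitrary \<open>f\<close> applies.
  Nonnegative integrals avoid integrability conditions.\<close>

lemma nn_integral_Ionescu_Tulcea_C:
  "(\<integral>\<^sup>+\<omega>. f (\<omega> t) \<partial>Ionescu_Tulcea.C (step_kernel G \<pi> \<iota>) (\<lambda>_. count_space UNIV) 0 (Suc t) (\<lambda>_. undefined))
     = (\<integral>\<^sup>+x. f x \<partial>measure_pmf (pair_law G \<pi> \<iota> t))"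
proof -
  interpret Ionescu_Tulcea "step_kernel G \<pi> \<iota>" "\<lambda>_. count_space UNIV"
    by (rule Ionescu_Tulcea_step_kernel)
  \<comment> \<open>The empty history, the only point of the product over no coordinates.\<close>
  have u: "(\<lambda>_. undefined) \<in> space (PiM {0..<0} (\<lambda>_. count_space UNIV))"
    by (auto simp: space_PiM PiE_iff extensional_def)
  have step: "(\<integral>\<^sup>+\<omega>. g (\<omega> n) \<partial>C 0 (Suc n) (\<lambda>_. undefined))
      = (\<integral>\<^sup>+\<omega>. (\<integral>\<^sup>+x. g x \<partial>step_kernel G \<pi> \<iota> n \<omega>) \<partial>C 0 n (\<lambda>_. undefined))" for g :: "_ \<Rightarrow> ennreal" and n
  proof -
    have m: "(\<lambda>\<omega>. g (\<omega> n)) \<in> borel_measurable (PiM {0..<Suc n} (\<lambda>_. count_space UNIV))"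
      by (rule measurable_compose[OF measurable_component_singleton]) auto
    have "(\<integral>\<^sup>+\<omega>. g (\<omega> n) \<partial>C 0 (Suc n) (\<lambda>_. undefined))
      = (\<integral>\<^sup>+\<omega>. (\<integral>\<^sup>+\<omega>'. g (\<omega>' n) \<partial>eP n \<omega>) \<partial>C 0 n (\<lambda>_. undefined))"
      unfolding C.simps using m measurable_eP[of n] sets_C[OF u, of n]
      by (subst nn_integral_bind[where B="PiM {0..<Suc n} (\<lambda>_. count_space UNIV)"])
         (auto cong: measurable_cong_sets)
    also have "\<dots> = (\<integral>\<^sup>+\<omega>. (\<integral>\<^sup>+x. g x \<partial>step_kernel G \<pi> \<iota> n \<omega>) \<partial>C 0 n (\<lambda>_. undefined))"
      using m space_C[OF u, of n] by (intro nn_integral_cong) (subst nn_integral_eP, auto)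
    finally show ?thesis .
  qed
  show ?thesis
  proof (induction t arbitrary: f)
    case 0
    show ?case
      unfolding step by (simp add: step_kernel_simps nn_integral_return u)
  next
    case (Suc t)
    \<comment> \<open>Markov property: the induction hypothesis is used for the average of
      \<open>f\<close> over one transition.\<close>
    show ?case
      unfolding step[of "Suc t"] step_kernel_simps Suc.IH[of "\<lambda>y. \<integral>\<^sup>+x. f x \<partial>measure_pmf (trans G (fst y) (snd y) \<bind> start_state \<pi>)"]
      by simp
  qed
qed

lemma sets_trajectory:
  "sets (trajectory G \<pi> \<iota>) = sets (PiM UNIV (\<lambda>_. count_space UNIV))"
proof -
  interpret Ionescu_Tulcea "step_kernel G \<pi> \<iota>" "\<lambda>_. count_space UNIV"
    by (rule Ionescu_Tulcea_step_kernel)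
  show ?thesis by (simp add: trajectory_def)
qed

lemma measurable_trajectory [measurable]:
  "(\<lambda>\<omega>. \<omega> t) \<in> trajectory G \<pi> \<iota> \<rightarrow>\<^sub>M count_space UNIV"
  unfolding measurable_cong_sets[OF sets_trajectory refl]
  by (rule measurable_component_singleton) simp

text \<open>Evaluation at \<open>t\<close> factors through the projection to the coordinate set
  \<open>{t}\<close>, where the projective limit agrees with the finite-horizon measure.\<close>

lemma distr_trajectory:
  "distr (trajectory G \<pi> \<iota>) (count_space UNIV) (\<lambda>\<omega>. \<omega> t) = measure_pmf (pair_law G \<pi> \<iota> t)"
proof -
  interpret Ionescu_Tulcea "step_kernel G \<pi> \<iota>" "\<lambda>_. count_space UNIV"
    by (rule Ionescu_Tulcea_step_kernel)
  let ?M = "\<lambda>_::nat. count_space UNIV :: ('a \<times> (nat \<Rightarrow> 'b)) measure"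
  have u: "(\<lambda>_. undefined) \<in> space (PiM {0..<0} ?M)"
    by (auto simp: space_PiM PiE_iff extensional_def)
  \<comment> \<open>The horizon is exclusive: reaching coordinate \<open>t\<close> takes the
    coordinates below \<open>Suc t\<close>.\<close>
  have up: "up_to {t} = Suc t"
    using up_to_iff[of "{t}"] by (intro antisym) (auto simp: Suc_le_eq up_to_less)
  have comp: "(\<lambda>\<omega>. \<omega> t) \<in> PiM {t} ?M \<rightarrow>\<^sub>M count_space UNIV"
    by (rule measurable_component_singleton) simp
  have restr: "(\<lambda>\<omega>. restrict \<omega> {t}) \<in> PiM J ?M \<rightarrow>\<^sub>M PiM {t} ?M" if "t \<in> J" for J
    using that by (intro measurable_restrict_subset) auto
  have "distr (trajectory G \<pi> \<iota>) (count_space UNIV) (\<lambda>\<omega>. \<omega> t)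
      = distr (distr PF.lim (PiM {t} ?M) (\<lambda>\<omega>. restrict \<omega> {t})) (count_space UNIV) (\<lambda>\<omega>. \<omega> t)"
    unfolding trajectory_def using comp restr[of UNIV]
    by (subst distr_distr) (auto simp: comp_def cong: measurable_cong_sets)
  also have "\<dots> = distr (distr (C 0 (Suc t) (\<lambda>_. undefined)) (PiM {t} ?M) (\<lambda>\<omega>. restrict \<omega> {t}))
      (count_space UNIV) (\<lambda>\<omega>. \<omega> t)"
    by (simp add: distr_lim CI_def up)
  also have "\<dots> = distr (C 0 (Suc t) (\<lambda>_. undefined)) (count_space UNIV) (\<lambda>\<omega>. \<omega> t)"
    using comp restr[of "{0..<Suc t}"] sets_C[OF u, of "Suc t"]
    by (subst distr_distr) (auto simp: comp_def cong: measurable_cong_sets)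
  also have "\<dots> = measure_pmf (pair_law G \<pi> \<iota> t)"
  proof (rule measure_eqI)
    fix X :: "('a \<times> (nat \<Rightarrow> 'b)) set"
    have m: "(\<lambda>\<omega>. \<omega> t) \<in> C 0 (Suc t) (\<lambda>_. undefined) \<rightarrow>\<^sub>M count_space UNIV"
      unfolding measurable_cong_sets[OF sets_C[OF u] refl]
      by (rule measurable_component_singleton) simp
    have "emeasure (distr (C 0 (Suc t) (\<lambda>_. undefined)) (count_space UNIV) (\<lambda>\<omega>. \<omega> t)) X
        = (\<integral>\<^sup>+\<omega>. indicator X (\<omega> t) \<partial>C 0 (Suc t) (\<lambda>_. undefined))"
      by (subst nn_integral_indicator[symmetric])
         (simp_all del: nn_integral_indicator C.simps add: nn_integral_distr[OF m])
    then show "emeasure (distr (C 0 (Suc t) (\<lambda>_. undefined)) (count_space UNIV) (\<lambda>\<omega>. \<omega> t)) X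
        = emeasure (measure_pmf (pair_law G \<pi> \<iota> t)) X"
      by (simp only: nn_integral_Ionescu_Tulcea_C nn_integral_indicator sets_measure_pmf UNIV_I)
  qed simp
  finally show ?thesis .
qed

section \<open>Discounted expectations\<close>

lemma pair_law_bind:
  "pair_law G \<pi> (M \<bind> f) t = M \<bind> (\<lambda>x. pair_law G \<pi> (f x) t)"
  by (induction t) (simp_all add: bind_assoc_pmf)

text \<open>Time homogeneity: the recursion appends the last transition, while Bellman equations
  need the first one split off.\<close>

lemma pair_law_Suc_shift:
  "pair_law G \<pi> \<iota> (Suc t) =
     pair_law G \<pi> (\<iota> \<bind> (\<lambda>x. trans G (fst x) (snd x) \<bind> start_state \<pi>)) t"
  by (induction t) simp_all

lemma map_fst_start_state: "map_pmf fst (M \<bind> start_state \<pi>) = M"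
  by (simp add: start_state_def map_bind_pmf pmf.map_comp comp_def bind_return_pmf')

text \<open>At every time the action is drawn afresh from \<open>\<pi>\<close> given the state,
  because each marginal has the form \<open>M \<bind> start_state \<pi>\<close>.\<close>

lemma pair_law_start_state:
  "pair_law G \<pi> (\<mu> \<bind> start_state \<pi>) t =
     map_pmf fst (pair_law G \<pi> (\<mu> \<bind> start_state \<pi>) t) \<bind> start_state \<pi>"
proof (cases t)
  case (Suc m)
  obtain M where "pair_law G \<pi> (\<mu> \<bind> start_state \<pi>) t = M \<bind> start_state \<pi>"
    unfolding Suc pair_law.simps bind_assoc_pmf[symmetric] by blast
  then show ?thesis by (simp add: map_fst_start_state)
qed (simp add: map_fst_start_state)

lemma set_pmf_start_state: "set_pmf (start_state \<pi> s) = Pair s ` set_pmf (\<pi> s)"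
  by (simp add: start_state_def)

lemma expectation_bind_finite:
  fixes h :: "'b \<Rightarrow> real"
  assumes "finite (set_pmf M)" "\<And>x. x \<in> set_pmf M \<Longrightarrow> finite (set_pmf (f x))"
  shows "measure_pmf.expectation (M \<bind> f) h =
    measure_pmf.expectation M (\<lambda>x. measure_pmf.expectation (f x) h)"
  using assms by (simp add: pmf_expectation_bind[where A="set_pmf M"]
      integral_measure_pmf[where A="set_pmf M"])

lemma expectation_abs_le:
  fixes f :: "'b \<Rightarrow> real"
  assumes "finite (set_pmf M)" "\<And>x. x \<in> set_pmf M \<Longrightarrow> \<bar>f x\<bar> \<le> C"
  shows "\<bar>measure_pmf.expectation M f\<bar> \<le> C"
proof -
  have "\<bar>measure_pmf.expectation M f\<bar> \<le> measure_pmf.expectation M (\<lambda>x. \<bar>f x\<bar>)"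
    by (rule integral_abs_bound)
  also have "\<dots> \<le> measure_pmf.expectation M (\<lambda>_. C)"
    using assms by (intro integral_mono_AE integrable_measure_pmf_finite) (auto simp: AE_measure_pmf_iff)
  finally show ?thesis by simp
qed

text \<open>Excludes mass on functions that are not joint actions, where \<open>trans\<close> and
  \<open>reward\<close> are arbitrary, and makes all supports finite.\<close>

definition joint_policy :: "('s, 'a) markov_game \<Rightarrow> ('s, 'a) policy \<Rightarrow> bool" where
  "joint_policy G \<pi> \<longleftrightarrow> (\<forall>s. set_pmf (\<pi> s) \<subseteq> joint_actions G (agents G))"

abbreviation state_actions :: "('s, 'a) markov_game \<Rightarrow> ('s \<times> (nat \<Rightarrow> 'a)) set" where
  "state_actions G \<equiv> UNIV \<times> joint_actions G (agents G)"

lemma finite_joint_actions: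
  "is_markov_game G \<Longrightarrow> finite (joint_actions G (agents G))"
  by (intro finite_PiE) (auto simp: is_markov_game_def agents_def)

lemma finite_state_actions:
  "is_markov_game G \<Longrightarrow> finite (state_actions G)"
  by (simp add: finite_joint_actions)

lemma set_pair_law:
  assumes "joint_policy G \<pi>" "set_pmf \<iota> \<subseteq> state_actions G"
  shows "set_pmf (pair_law G \<pi> \<iota> t) \<subseteq> state_actions G"
  using assms by (cases t) (auto simp: set_pmf_start_state joint_policy_def)

lemma discount_bounds: "is_markov_game G \<Longrightarrow> 0 \<le> discount G" "is_markov_game G \<Longrightarrow> discount G < 1"
  by (auto simp: is_markov_game_def)

lemma finite_set_pmf_state_actions:
  fixes G :: "('s::finite, 'a) markov_game"
  assumes "is_markov_game G" "set_pmf \<iota> \<subseteq> state_actions G"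
  shows "finite (set_pmf \<iota>)"
  using assms finite_state_actions finite_subset by blast

lemma bounded_on_state_actions:
  fixes G :: "('s::finite, 'a) markov_game"
  assumes "is_markov_game G"
  obtains C :: real where "\<And>x. x \<in> state_actions G \<Longrightarrow> \<bar>f x\<bar> \<le> C"
proof
  show "\<bar>f x\<bar> \<le> (\<Sum>x\<in>state_actions G. \<bar>f x\<bar> :: real)" if "x \<in> state_actions G" for x
    using that finite_state_actions[OF assms] by (intro member_le_sum) auto
qed

text \<open>One functional for state values, action values and visitation: they differ only in the
  initial law and the reward \<open>f\<close>.\<close>

definition discounted ::
  "('s, 'a) markov_game \<Rightarrow> ('s, 'a) policy \<Rightarrow> ('s \<times> (nat \<Rightarrow> 'a)) pmf \<Rightarrow> ('s \<times> (nat \<Rightarrow> 'a) \<Rightarrow> real) \<Rightarrow> real"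
where
  "discounted G \<pi> \<iota> f = (\<Sum>t. discount G ^ t * measure_pmf.expectation (pair_law G \<pi> \<iota> t) f)"

section \<open>Calculus of discounted sums under a fixed policy\<close>

context
  fixes G :: "('s::finite, 'a) markov_game" and \<pi> :: "('s, 'a) policy"
  assumes game: "is_markov_game G" and policy: "joint_policy G \<pi>"
begin

lemma finite_set_pair_law:
  "set_pmf \<iota> \<subseteq> state_actions G \<Longrightarrow> finite (set_pmf (pair_law G \<pi> \<iota> t))"
  using set_pair_law[OF policy] finite_set_pmf_state_actions[OF game] by blast

lemma set_start_state: "set_pmf (start_state \<pi> s) \<subseteq> state_actions G"
  using policy by (auto simp: set_pmf_start_state joint_policy_def)

lemma set_bind_start_state: "set_pmf (M \<bind> start_state \<pi>) \<subseteq> state_actions G"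
  using set_start_state by auto

lemma expectation_pair_law_bound:
  assumes "set_pmf \<iota> \<subseteq> state_actions G" "\<And>x. x \<in> state_actions G \<Longrightarrow> \<bar>f x\<bar> \<le> C"
  shows "\<bar>discount G ^ t * measure_pmf.expectation (pair_law G \<pi> \<iota> t) f\<bar> \<le> C * discount G ^ t"
proof -
  have "\<bar>measure_pmf.expectation (pair_law G \<pi> \<iota> t) f\<bar> \<le> C"
    using assms finite_set_pair_law set_pair_law[OF policy assms(1), of t]
    by (intro expectation_abs_le) auto
  then show ?thesis
    using discount_bounds[OF game] by (simp add: abs_mult mult.commute[of C] mult_left_mono)
qed

lemma summable_discounted:
  assumes "set_pmf \<iota> \<subseteq> state_actions G"
  shows "summable (\<lambda>t. discount G ^ t * measure_pmf.expectation (pair_law G \<pi> \<iota> t) f)"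
proof -
  obtain C where C: "\<And>x. x \<in> state_actions G \<Longrightarrow> \<bar>f x\<bar> \<le> C"
    using bounded_on_state_actions[OF game, of f] by metis
  show ?thesis
  proof (rule summable_comparison_test')
    show "summable (\<lambda>t. C * discount G ^ t)"
      using discount_bounds[OF game] by (intro summable_mult summable_geometric) auto
    show "norm (discount G ^ t * measure_pmf.expectation (pair_law G \<pi> \<iota> t) f) \<le> C * discount G ^ t"
      if "t \<ge> 0" for t
      using expectation_pair_law_bound[OF assms C] by simp
  qed
qed

lemma abs_discounted_le:
  assumes "set_pmf \<iota> \<subseteq> state_actions G" "\<And>x. x \<in> state_actions G \<Longrightarrow> \<bar>f x\<bar> \<le> C"
  shows "\<bar>discounted G \<pi> \<iota> f\<bar> \<le> C / (1 - discount G)"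
proof -
  have g: "summable (\<lambda>t. C * discount G ^ t)"
    using discount_bounds[OF game] by (intro summable_mult summable_geometric) auto
  have "\<bar>discounted G \<pi> \<iota> f\<bar> \<le> (\<Sum>t. C * discount G ^ t)"
    unfolding discounted_def real_norm_def[symmetric]
    using expectation_pair_law_bound[OF assms] by (intro norm_suminf_le g) auto
  also have "\<dots> = C / (1 - discount G)"
    using discount_bounds[OF game] by (simp add: suminf_mult suminf_geometric)
  finally show ?thesis .
qed

text \<open>A mixture over a finite support is a finite weighted sum, which commutes with the
  convergent series.\<close>

lemma discounted_bind:
  assumes "finite (set_pmf M)" "\<And>x. x \<in> set_pmf M \<Longrightarrow> set_pmf (g x) \<subseteq> state_actions G"
  shows "discounted G \<pi> (M \<bind> g) f = measure_pmf.expectation M (\<lambda>x. discounted G \<pi> (g x) f)"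
proof -
  have "discounted G \<pi> (M \<bind> g) f =
     (\<Sum>t. \<Sum>x\<in>set_pmf M. pmf M x * (discount G ^ t * measure_pmf.expectation (pair_law G \<pi> (g x) t) f))"
    unfolding discounted_def pair_law_bind using assms
    by (simp add: expectation_bind_finite finite_set_pair_law integral_measure_pmf[where A="set_pmf M"]
        sum_distrib_left mult.left_commute)
  also have "\<dots> = (\<Sum>x\<in>set_pmf M. pmf M x * discounted G \<pi> (g x) f)"
    unfolding discounted_def using assms(2)
    by (subst suminf_sum) (auto intro!: summable_mult summable_discounted sum.cong suminf_mult)
  finally show ?thesis
    using assms(1) by (simp add: integral_measure_pmf[where A="set_pmf M"])
qed

lemma discounted_bind_start_state:
  "discounted G \<pi> (M \<bind> start_state \<pi>) f =
    measure_pmf.expectation M (\<lambda>s. discounted G \<pi> (start_state \<pi> s) f)"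
  by (rule discounted_bind) (use set_start_state in auto)

lemma discounted_cong:
  assumes "set_pmf \<iota> \<subseteq> state_actions G" "\<And>x. x \<in> state_actions G \<Longrightarrow> f x = g x"
  shows "discounted G \<pi> \<iota> f = discounted G \<pi> \<iota> g"
proof -
  have "f x = g x" if "x \<in> set_pmf (pair_law G \<pi> \<iota> t)" for x t
    using set_pair_law[OF policy assms(1)] that assms(2) by blast
  then show ?thesis
    unfolding discounted_def
    by (intro suminf_cong arg_cong2[where f="(*)"] refl integral_cong_AE) (auto simp: AE_measure_pmf_iff)
qed

lemma discounted_add:
  assumes "set_pmf \<iota> \<subseteq> state_actions G"
  shows "discounted G \<pi> \<iota> (\<lambda>x. f x + g x) = discounted G \<pi> \<iota> f + discounted G \<pi> \<iota> g"
  unfolding discounted_def suminf_add[OF summable_discounted[OF assms] summable_discounted[OF assms]]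
  using assms
  by (simp add: distrib_left integrable_measure_pmf_finite finite_set_pair_law)

lemma discounted_mult:
  assumes "set_pmf \<iota> \<subseteq> state_actions G"
  shows "discounted G \<pi> \<iota> (\<lambda>x. c * f x) = c * discounted G \<pi> \<iota> f"
  unfolding discounted_def suminf_mult[OF summable_discounted[OF assms], symmetric]
  by (simp add: mult.left_commute)

text \<open>Bellman equation for initial laws: split off time 0 and shift the remaining
  series.\<close>

lemma discounted_unfold:
  assumes "set_pmf \<iota> \<subseteq> state_actions G"
  shows "discounted G \<pi> \<iota> f = measure_pmf.expectation \<iota> f +
    discount G * discounted G \<pi> (\<iota> \<bind> (\<lambda>x. trans G (fst x) (snd x) \<bind> start_state \<pi>)) f"
proof -
  have \<iota>': "set_pmf (\<iota> \<bind> (\<lambda>x. trans G (fst x) (snd x) \<bind> start_state \<pi>)) \<subseteq> state_actions G"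
    unfolding bind_assoc_pmf[symmetric] by (rule set_bind_start_state)
  show ?thesis
    using suminf_split_head[OF summable_discounted[OF assms, of f]]
      suminf_mult[OF summable_discounted[OF \<iota>', of f], of "discount G"]
    by (simp add: discounted_def pair_law_Suc_shift mult.assoc del: pair_law.simps(2))
qed

text \<open>Moves a transition from the initial law to the integrand, as both sides describe time
  \<open>Suc t\<close>; this enables telescoping.\<close>

lemma discounted_transition:
  assumes "set_pmf \<iota> \<subseteq> state_actions G"
  shows "discounted G \<pi> (\<iota> \<bind> (\<lambda>x. trans G (fst x) (snd x) \<bind> start_state \<pi>)) f =
    discounted G \<pi> \<iota> (\<lambda>x. measure_pmf.expectation (trans G (fst x) (snd x) \<bind> start_state \<pi>) f)"
  unfolding discounted_def pair_law_Suc_shift[symmetric] pair_law.simps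
  using assms set_start_state
  by (subst expectation_bind_finite)
     (auto simp: finite_set_pair_law intro!: finite_set_pmf_state_actions[OF game])

end

section \<open>Performance difference and policy gradient\<close>

context
  fixes G :: "('s::finite, 'a) markov_game" and \<pi> :: "('s, 'a) policy"
  assumes game: "is_markov_game G" and policy: "joint_policy G \<pi>"
begin

text \<open>The geometric bound on the discounted rewards allows integral and series to be
  exchanged, after which only the marginals matter.\<close>

lemma integral_return_of:
  assumes \<iota>: "set_pmf \<iota> \<subseteq> state_actions G"
  shows "(LINT \<omega> | trajectory G \<pi> \<iota>. return_of G \<omega>) = discounted G \<pi> \<iota> (\<lambda>x. reward G (fst x) (snd x))"
proof -
  let ?T = "trajectory G \<pi> \<iota>" and ?r = "\<lambda>x. reward G (fst x) (snd x)"
  obtain C where C: "\<And>x. x \<in> state_actions G \<Longrightarrow> \<bar>?r x\<bar> \<le> C"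
    using bounded_on_state_actions[OF game, of ?r] by metis
  note \<gamma> = discount_bounds[OF game]
  have summ: "summable (\<lambda>t. C * discount G ^ t)"
    using \<gamma> by (intro summable_mult summable_geometric) auto
  have int: "integrable ?T (\<lambda>\<omega>. f (\<omega> t))" for t and f :: "_ \<Rightarrow> real"
    using integrable_distr_eq[OF measurable_trajectory, of f G \<pi> \<iota> t]
    by (simp add: distr_trajectory integrable_measure_pmf_finite finite_set_pair_law[OF game policy \<iota>])
  have LINT: "(LINT \<omega> | ?T. f (\<omega> t)) = measure_pmf.expectation (pair_law G \<pi> \<iota> t) f"
    for t and f :: "_ \<Rightarrow> real"
    using integral_distr[OF measurable_trajectory, of f G \<pi> \<iota> t] by (simp add: distr_trajectory)
  \<comment> \<open>The bound \<open>C\<close> fails to control rewards off the joint actions, so it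
    is available only almost surely.\<close>
  have AE: "AE \<omega> in ?T. \<forall>t. \<omega> t \<in> state_actions G"
  proof (subst AE_all_countable, rule allI)
    fix t
    have "AE x in distr ?T (count_space UNIV) (\<lambda>\<omega>. \<omega> t). x \<in> state_actions G"
      unfolding distr_trajectory using set_pair_law[OF policy \<iota>, of t]
      by (auto simp: AE_measure_pmf_iff)
    then show "AE \<omega> in ?T. \<omega> t \<in> state_actions G"
      by (subst (asm) AE_distr_iff) auto
  qed
  show ?thesis
    unfolding return_of_def discounted_def
  proof (subst integral_suminf)
    show "AE \<omega> in ?T. summable (\<lambda>t. norm (discount G ^ t * reward G (fst (\<omega> t)) (snd (\<omega> t))))"
      using AE
    proof eventually_elim
      case (elim \<omega>)
      have "\<bar>?r (\<omega> t)\<bar> \<le> C" for t using elim C by blast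
      then show ?case
        using \<gamma> by (intro summable_comparison_test'[OF summ])
          (auto simp: abs_mult mult.commute[of C] intro!: mult_left_mono)
    qed
    show "summable (\<lambda>t. LINT \<omega> | ?T. norm (discount G ^ t * reward G (fst (\<omega> t)) (snd (\<omega> t))))"
      using summable_discounted[OF game policy \<iota>, of "\<lambda>x. \<bar>?r x\<bar>"] \<gamma>
        LINT[of "\<lambda>x. \<bar>?r x\<bar>"]
      by (simp add: abs_mult)
  qed (use int[of ?r] LINT[of ?r] in auto)
qed

lemma state_value_eq: "state_value G \<pi> s = discounted G \<pi> (start_state \<pi> s) (\<lambda>x. reward G (fst x) (snd x))"
  unfolding state_value_def by (rule integral_return_of[OF set_start_state[OF game policy]])

lemma action_value_eq:
  "a \<in> joint_actions G (agents G) \<Longrightarrow>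
    action_value G \<pi> s a = discounted G \<pi> (return_pmf (s, a)) (\<lambda>x. reward G (fst x) (snd x))"
  unfolding action_value_def by (rule integral_return_of) simp

lemma game_value_eq:
  "game_value G \<pi> = discounted G \<pi> (init_dist G \<bind> start_state \<pi>) (\<lambda>x. reward G (fst x) (snd x))"
  by (simp add: game_value_def state_value_eq[abs_def] discounted_bind_start_state[OF game policy])

text \<open>The probability of \<open>s\<close> at time \<open>t\<close> is the expectation of an
  indicator; hence the performance difference lemma applies to visitation too.\<close>

lemma visitation_eq:
  "visitation G \<pi> s = discounted G \<pi> (init_dist G \<bind> start_state \<pi>) (\<lambda>x. indicator {s} (fst x))"
proof -
  have "measure (trajectory G \<pi> \<iota>) {\<omega> \<in> space (trajectory G \<pi> \<iota>). fst (\<omega> t) = s} =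
      measure_pmf.expectation (pair_law G \<pi> \<iota> t) (\<lambda>x. indicator {s} (fst x))" for \<iota> t
  proof -
    have "measure_pmf.expectation (pair_law G \<pi> \<iota> t) (\<lambda>x. indicator {s} (fst x)) =
      measure_pmf.prob (pair_law G \<pi> \<iota> t) {x. fst x = s}"
    proof -
      have "(\<lambda>x :: 's \<times> (nat \<Rightarrow> 'a). indicator {s} (fst x) :: real) = indicator {x. fst x = s}"
        by (auto simp: indicator_def fun_eq_iff)
      then show ?thesis by simp
    qed
    also have "\<dots> = measure (trajectory G \<pi> \<iota>) ((\<lambda>\<omega>. \<omega> t) -` {x. fst x = s} \<inter> space (trajectory G \<pi> \<iota>))"
      unfolding distr_trajectory[symmetric] by (rule measure_distr) auto
    finally show ?thesis
      by (simp add: vimage_def Int_def conj_commute)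
  qed
  then show ?thesis
    unfolding discounted_bind_start_state[OF game policy] by (simp add: visitation_def discounted_def)
qed

lemma discounted_start_state:
  "discounted G \<pi> (start_state \<pi> s) f =
    (\<Sum>a\<in>joint_actions G (agents G). pmf (\<pi> s) a * discounted G \<pi> (return_pmf (s, a)) f)"
proof -
  have sub: "set_pmf (\<pi> s) \<subseteq> joint_actions G (agents G)"
    using policy by (auto simp: joint_policy_def)
  note fin = finite_joint_actions[OF game]
  have "start_state \<pi> s = \<pi> s \<bind> (\<lambda>a. return_pmf (s, a))"
    by (simp add: start_state_def map_pmf_def)
  then show ?thesis
    using sub by (auto simp: discounted_bind[OF game policy] finite_subset[OF sub fin]
        integral_measure_pmf[OF fin, of "\<pi> s"] subset_eq)
qed

text \<open>Bellman equation for action values with a general reward.\<close>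

lemma discounted_return_pmf:
  assumes "a \<in> joint_actions G (agents G)"
  shows "discounted G \<pi> (return_pmf (s, a)) f =
    f (s, a) + discount G * measure_pmf.expectation (trans G s a) (\<lambda>s'. discounted G \<pi> (start_state \<pi> s') f)"
  using assms by (subst discounted_unfold[OF game policy])
    (auto simp: bind_return_pmf discounted_bind_start_state[OF game policy])

text \<open>By \<open>pair_law_start_state\<close>, \<open>f\<close> may be replaced by its average
  \<open>g\<close> over the actions; the series is then grouped by states.\<close>

lemma discounted_by_visitation:
  "discounted G \<pi> (init_dist G \<bind> start_state \<pi>) f =
    (\<Sum>s\<in>UNIV. visitation G \<pi> s * (\<Sum>a\<in>joint_actions G (agents G). pmf (\<pi> s) a * f (s, a)))"
proof -
  note fin = finite_joint_actions[OF game]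
  let ?\<iota> = "init_dist G \<bind> start_state \<pi>"
  have \<iota>: "set_pmf ?\<iota> \<subseteq> state_actions G"
    by (rule set_bind_start_state[OF game policy])
  define g where "g s = (\<Sum>a\<in>joint_actions G (agents G). pmf (\<pi> s) a * f (s, a))" for s
  have start: "measure_pmf.expectation (start_state \<pi> s) f = g s" for s
    using policy unfolding start_state_def g_def
    by (simp add: integral_measure_pmf[OF fin, of "\<pi> s"] joint_policy_def subset_eq)
  have "measure_pmf.expectation (pair_law G \<pi> ?\<iota> t) f =
      (\<Sum>s\<in>UNIV. measure_pmf.expectation (pair_law G \<pi> ?\<iota> t) (\<lambda>x. indicator {s} (fst x)) * g s)" for t
  proof -
    let ?L = "pair_law G \<pi> ?\<iota> t"
    have "measure_pmf.expectation ?L f = measure_pmf.expectation (map_pmf fst ?L \<bind> start_state \<pi>) f"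
      by (subst pair_law_start_state) simp
    also have "\<dots> = measure_pmf.expectation ?L (\<lambda>x. g (fst x))"
      by (subst expectation_bind_finite)
         (simp_all add: start finite_set_pmf_state_actions[OF game set_start_state[OF game policy]])
    also have "\<dots> = measure_pmf.expectation ?L (\<lambda>x. \<Sum>s\<in>UNIV. indicator {s} (fst x) * g s)"
      by (intro Bochner_Integration.integral_cong refl) (simp add: indicator_def of_bool_def if_distrib[of "\<lambda>y. y * _"] cong: if_cong)
    also have "\<dots> = (\<Sum>s\<in>UNIV. measure_pmf.expectation ?L (\<lambda>x. indicator {s} (fst x)) * g s)"
      using finite_set_pair_law[OF game policy \<iota>]
      by (subst Bochner_Integration.integral_sum) (auto intro: integrable_measure_pmf_finite)
    finally show ?thesis .
  qed
  then have "discounted G \<pi> ?\<iota> f = (\<Sum>t. \<Sum>s\<in>UNIV.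
      discount G ^ t * measure_pmf.expectation (pair_law G \<pi> ?\<iota> t) (\<lambda>x. indicator {s} (fst x)) * g s)"
    by (simp add: discounted_def sum_distrib_left mult.assoc)
  also have "\<dots> = (\<Sum>s\<in>UNIV. visitation G \<pi> s * g s)"
    unfolding visitation_eq discounted_def
    by (subst suminf_sum)
       (auto intro!: sum.cong suminf_mult2[symmetric] summable_mult2 summable_discounted[OF game policy \<iota>])
  finally show ?thesis by (simp add: g_def)
qed

text \<open>A bound uniform in \<open>\<pi>\<close>, usable before continuity of the visitation is
  known.\<close>

lemma visitation_le: "\<bar>visitation G \<pi> s\<bar> \<le> 1 / (1 - discount G)"
  unfolding visitation_eq
  by (rule abs_discounted_le[OF game policy set_bind_start_state[OF game policy]]) (simp split: split_indicator)

end

text \<open>Visitation belongs to the new policy and action values to the old one, so a difference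
  quotient at fixed \<open>\<pi>\<close> involves no varying action values.\<close>

lemma performance_difference:
  fixes G :: "('s::finite, 'a) markov_game"
  assumes game: "is_markov_game G" and \<pi>: "joint_policy G \<pi>" and \<pi>': "joint_policy G \<pi>'"
  shows "discounted G \<pi>' (init_dist G \<bind> start_state \<pi>') f - discounted G \<pi> (init_dist G \<bind> start_state \<pi>) f =
    (\<Sum>s\<in>UNIV. visitation G \<pi>' s * (\<Sum>a\<in>joint_actions G (agents G).
       (pmf (\<pi>' s) a - pmf (\<pi> s) a) * discounted G \<pi> (return_pmf (s, a)) f))"
proof -
  let ?\<iota> = "init_dist G \<bind> start_state \<pi>'" and ?A = "joint_actions G (agents G)"
  note fin = finite_joint_actions[OF game]
  have \<iota>: "set_pmf ?\<iota> \<subseteq> state_actions G"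
    by (rule set_bind_start_state[OF game \<pi>'])
  define V where "V s = discounted G \<pi> (start_state \<pi> s) f" for s
  define Q where "Q x = discounted G \<pi> (return_pmf x) f" for x
  have Q_eq: "Q (s, a) = f (s, a) + discount G * measure_pmf.expectation (trans G s a) V" if "a \<in> ?A" for s a
    using discounted_return_pmf[OF game \<pi> that] by (simp add: Q_def V_def[abs_def])
  have finK: "finite (set_pmf (start_state \<pi>' s))" for s
    by (rule finite_set_pmf_state_actions[OF game set_start_state[OF game \<pi>']])
  have V_start: "measure_pmf.expectation (M \<bind> start_state \<pi>') (\<lambda>x. V (fst x)) = measure_pmf.expectation M V" for M
    by (subst expectation_bind_finite) (auto simp: finK, simp add: start_state_def)
  \<comment> \<open>Solve the Bellman equation of \<open>Q\<close> for \<open>f\<close>, then add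
    and subtract \<open>V\<close>: an advantage plus a telescoping term.\<close>
  have "discounted G \<pi>' ?\<iota> f = discounted G \<pi>' ?\<iota> (\<lambda>x. (Q x - V (fst x)) + (V (fst x) +
      - discount G * measure_pmf.expectation (trans G (fst x) (snd x) \<bind> start_state \<pi>') (\<lambda>x. V (fst x))))"
    by (rule discounted_cong[OF game \<pi>' \<iota>])
       (auto simp: V_start Q_eq)
  \<comment> \<open>The second summand collapses to its contribution at time 0.\<close>
  also have "\<dots> = discounted G \<pi>' ?\<iota> (\<lambda>x. Q x - V (fst x)) + measure_pmf.expectation ?\<iota> (\<lambda>x. V (fst x))"
    unfolding discounted_add[OF game \<pi>' \<iota>] discounted_mult[OF game \<pi>' \<iota>]
      discounted_unfold[OF game \<pi>' \<iota>, of "\<lambda>x. V (fst x)"] discounted_transition[OF game \<pi>' \<iota>]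
    by simp
  \<comment> \<open>\<open>V\<close> sees only the state, and the initial state has the same law
    under both policies.\<close>
  also have "measure_pmf.expectation ?\<iota> (\<lambda>x. V (fst x)) = discounted G \<pi> (init_dist G \<bind> start_state \<pi>) f"
    unfolding V_start by (simp add: V_def[abs_def] discounted_bind_start_state[OF game \<pi>])
  finally have "discounted G \<pi>' ?\<iota> f - discounted G \<pi> (init_dist G \<bind> start_state \<pi>) f =
      (\<Sum>s\<in>UNIV. visitation G \<pi>' s * (\<Sum>a\<in>?A. pmf (\<pi>' s) a * (Q (s, a) - V s)))"
    by (simp add: discounted_by_visitation[OF game \<pi>'])
  \<comment> \<open>\<open>\<pi>'\<close> has total mass 1, and the baseline \<open>V s\<close> is
    the \<open>\<pi>\<close>-average of \<open>Q\<close>.\<close>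
  moreover have "(\<Sum>a\<in>?A. pmf (\<pi>' s) a * (Q (s, a) - V s)) = (\<Sum>a\<in>?A. (pmf (\<pi>' s) a - pmf (\<pi> s) a) * Q (s, a))" for s
  proof -
    have "(\<Sum>a\<in>?A. pmf (\<pi>' s) a) = 1"
      using \<pi>' fin by (intro sum_pmf_eq_1) (auto simp: joint_policy_def)
    then have "(\<Sum>a\<in>?A. pmf (\<pi>' s) a * (Q (s, a) - V s)) = (\<Sum>a\<in>?A. pmf (\<pi>' s) a * Q (s, a)) - V s"
      by (simp add: right_diff_distrib sum_subtractf sum_distrib_right[symmetric])
    then show ?thesis
      by (simp add: V_def Q_def discounted_start_state[OF game \<pi>] left_diff_distrib sum_subtractf)
  qed
  ultimately show ?thesis by (simp add: Q_def)
qed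

text \<open>Only the policy probabilities need be differentiable along the curve: in the exact
  difference formula the action values are frozen at \<open>x0\<close>, and continuity of the
  visitation suffices.\<close>

theorem policy_gradient:
  fixes G :: "('s::finite, 'a) markov_game" and \<pi> :: "real \<Rightarrow> ('s, 'a) policy"
  assumes game: "is_markov_game G" and \<pi>: "\<And>x. joint_policy G (\<pi> x)"
    and deriv: "\<And>s a. a \<in> joint_actions G (agents G) \<Longrightarrow>
      ((\<lambda>x. pmf (\<pi> x s) a) has_real_derivative D s a) (at x0)"
  shows "((\<lambda>x. game_value G (\<pi> x)) has_real_derivative
    (\<Sum>s\<in>UNIV. visitation G (\<pi> x0) s *
       (\<Sum>a\<in>joint_actions G (agents G). D s a * action_value G (\<pi> x0) s a))) (at x0)"
proof -
  let ?A = "joint_actions G (agents G)"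
  \<comment> \<open>The visitation measure is itself a value, for the reward \<open>indicator {s} \<circ> fst\<close>.\<close>
  have cont: "((\<lambda>x. visitation G (\<pi> x) s) \<longlongrightarrow> visitation G (\<pi> x0) s) (at x0)" for s
  proof -
    let ?f = "\<lambda>x :: 's \<times> (nat \<Rightarrow> 'a). indicator {s} (fst x) :: real"
    let ?g = "\<lambda>x s. \<Sum>a\<in>?A. (pmf (\<pi> x s) a - pmf (\<pi> x0 s) a) * discounted G (\<pi> x0) (return_pmf (s, a)) ?f"
    have "((\<lambda>x. ?g x s') \<longlongrightarrow> (\<Sum>a\<in>?A. (pmf (\<pi> x0 s') a - pmf (\<pi> x0 s') a) *
        discounted G (\<pi> x0) (return_pmf (s', a)) ?f)) (at x0)" for s'
      by (intro tendsto_intros DERIV_isCont[OF deriv, unfolded isCont_def])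
    then have "((\<lambda>x. 1 / (1 - discount G) * \<bar>?g x s'\<bar>) \<longlongrightarrow> 0) (at x0)" for s'
      by (intro tendsto_mult_right_zero tendsto_rabs_zero) simp
    \<comment> \<open>The visitation factor is only bounded so far, but \<open>?g\<close> tends to
      0.\<close>
    then have "((\<lambda>x. visitation G (\<pi> x) s' * ?g x s') \<longlongrightarrow> 0) (at x0)" for s'
      by (rule Lim_null_comparison[rotated])
         (auto simp: abs_mult intro!: mult_right_mono visitation_le[OF game \<pi>] always_eventually simp del: times_divide_eq_left)
    then have "((\<lambda>x. \<Sum>s'\<in>UNIV. visitation G (\<pi> x) s' * ?g x s') \<longlongrightarrow> (\<Sum>s'\<in>(UNIV :: 's set). 0)) (at x0)"
      by (intro tendsto_sum)
    then have "((\<lambda>x. visitation G (\<pi> x) s - visitation G (\<pi> x0) s) \<longlongrightarrow> 0) (at x0)"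
      by (simp add: visitation_eq[OF game \<pi>, of _ s] performance_difference[OF game \<pi> \<pi>])
    then show ?thesis by (simp add: LIM_zero_iff)
  qed
  \<comment> \<open>Valid also at \<open>x = x0\<close>, where division by zero makes both sides
    0.\<close>
  have quot: "(game_value G (\<pi> x) - game_value G (\<pi> x0)) / (x - x0) =
      (\<Sum>s\<in>UNIV. visitation G (\<pi> x) s * (\<Sum>a\<in>?A.
        (pmf (\<pi> x s) a - pmf (\<pi> x0 s) a) / (x - x0) * action_value G (\<pi> x0) s a))" for x
    by (simp add: game_value_eq[OF game \<pi>] performance_difference[OF game \<pi> \<pi>] action_value_eq[OF game \<pi>]
        sum_divide_distrib sum_distrib_left mult.assoc)
  show ?thesis
    unfolding has_field_derivative_iff quot
    by (intro tendsto_intros cont deriv[unfolded has_field_derivative_iff])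
qed

section \<open>Softmax Bayesian networks\<close>

text \<open>Extensions of \<open>x\<close> correspond to the fibre of restriction to
  \<open>K\<close> over \<open>x\<close>; fibres for different \<open>K\<close> are easier to
  compare than merged sums.\<close>

lemma sum_merge:
  fixes F :: "(nat \<Rightarrow> 'a) \<Rightarrow> real"
  assumes "K \<subseteq> I" "x \<in> Pi\<^sub>E K A"
  shows "(\<Sum>y\<in>Pi\<^sub>E (I - K) A. F (merge K (I - K) (x, y))) = (\<Sum>a | a \<in> Pi\<^sub>E I A \<and> restrict a K = x. F a)"
proof (rule sum.reindex_bij_witness[of _ "\<lambda>a. restrict a (I - K)" "\<lambda>y. merge K (I - K) (x, y)"])
  fix a assume a: "a \<in> {a \<in> Pi\<^sub>E I A. restrict a K = x}"
  then have "x k = a k" if "k \<in> K" for k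
    using that by auto
  then show "merge K (I - K) (x, restrict a (I - K)) = a"
    using a by (auto simp: merge_def fun_eq_iff PiE_iff extensional_def)
  show "restrict a (I - K) \<in> Pi\<^sub>E (I - K) A"
    using a by auto
next
  fix y assume y: "y \<in> Pi\<^sub>E (I - K) A"
  then show "restrict (merge K (I - K) (x, y)) (I - K) = y"
    by (auto simp: merge_def fun_eq_iff PiE_iff extensional_def)
  show "merge K (I - K) (x, y) \<in> {a \<in> Pi\<^sub>E I A. restrict a K = x}"
    using assms y by (auto simp: merge_def fun_eq_iff PiE_iff extensional_def subset_eq)
qed simp

lemma partial_action_value_eq:
  assumes "K \<subseteq> agents G" "x \<in> joint_actions G K"
  shows "partial_action_value G \<pi> K s x =
    (\<Sum>a | a \<in> joint_actions G (agents G) \<and> restrict a K = x. pmf (\<pi> s) a * action_value G \<pi> s a) /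
    (\<Sum>a | a \<in> joint_actions G (agents G) \<and> restrict a K = x. pmf (\<pi> s) a)"
proof -
  \<comment> \<open>\<open>cond_policy\<close> is applied to the complement of \<open>K\<close>, so
    its double complement and swapped \<open>merge\<close> must be undone.\<close>
  have "agents G - (agents G - K) = K" using assms(1) by auto
  moreover have "merge (agents G - K) K (y, x) = merge K (agents G - K) (x, y)" for y :: "nat \<Rightarrow> 'b"
    by (rule merge_commute) auto
  ultimately show ?thesis
    by (simp add: partial_action_value_def cond_policy_def sum_merge[OF assms, symmetric] sum_divide_distrib)
qed

lemma partial_visitation_distr_eq:
  assumes "K \<subseteq> agents G" "x \<in> joint_actions G K"
  shows "partial_visitation_distr G \<pi> K s x = visitation_distr G \<pi> s *
    (\<Sum>a | a \<in> joint_actions G (agents G) \<and> restrict a K = x. pmf (\<pi> s) a)"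
  by (simp add: partial_visitation_distr_def sum_merge[OF assms])

section \<open>Softmax policies and their derivatives\<close>

lemma pmf_softmax_policy_pos:
  assumes "is_markov_game G" "i \<in> agents G" "b \<in> actions G i"
  shows "pmf (softmax_policy G \<theta> i s p) b > 0"
proof -
  have "(\<Sum>c\<in>actions G i. exp (\<theta> (i, s, p, c))) > 0"
    using assms by (intro sum_pos) (auto simp: is_markov_game_def)
  then show ?thesis by (simp add: pmf_softmax_policy[OF assms(1,2)] assms(3))
qed

text \<open>A local policy reads only the parameters carrying its own agent, state and parent
  action.\<close>

lemma softmax_policy_update_other:
  "(k, s', q) \<noteq> (i, s, p) \<Longrightarrow> softmax_policy G (\<theta>((i, s, p, b) := x)) k s' q = softmax_policy G \<theta> k s' q"
  unfolding softmax_policy_def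
  by (intro arg_cong[where f=embed_pmf] ext if_cong arg_cong2[where f="(/)"] sum.cong) auto

text \<open>Quotient rule: the normalizer depends on the parameter through the numerator of
  \<open>b\<close> alone, and that exponential is its own derivative.\<close>

lemma has_derivative_softmax_policy:
  assumes game: "is_markov_game G" and i: "i \<in> agents G" and b: "b \<in> actions G i" and c: "c \<in> actions G i"
  shows "((\<lambda>x. pmf (softmax_policy G (\<theta>((i, s, p, b) := x)) i s p) c) has_real_derivative
    pmf (softmax_policy G \<theta> i s p) c * (of_bool (c = b) - pmf (softmax_policy G \<theta> i s p) b)) (at (\<theta> (i, s, p, b)))"
proof -
  let ?x0 = "\<theta> (i, s, p, b)"
  define num where "num d x = exp ((\<theta>((i, s, p, b) := x)) (i, s, p, d))" for d x
  define Z where "Z x = (\<Sum>d\<in>actions G i. num d x)" for x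
  have fin: "finite (actions G i)" "actions G i \<noteq> {}"
    using game i by (auto simp: is_markov_game_def)
  have Z: "Z ?x0 > 0"
    unfolding Z_def num_def using fin by (intro sum_pos) auto
  have num: "(num d has_real_derivative of_bool (d = b) * num d ?x0) (at ?x0)" for d
  proof (cases "d = b")
    case True
    then have "num d = exp" by (simp add: num_def fun_eq_iff)
    then show ?thesis using True by simp
  next
    case False
    then have "num d = (\<lambda>_. exp (\<theta> (i, s, p, d)))" by (simp add: num_def fun_eq_iff)
    then show ?thesis using False by simp
  qed
  have "(Z has_real_derivative (\<Sum>d\<in>actions G i. of_bool (d = b) * num d ?x0)) (at ?x0)"
    unfolding Z_def[abs_def] by (intro derivative_intros num)
  also have "(\<Sum>d\<in>actions G i. of_bool (d = b) * num d ?x0) = num b ?x0"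
    using fin b by (simp add: of_bool_def if_distrib[of "\<lambda>y. y * _"] cong: if_cong)
  finally have "((\<lambda>x. num c x / Z x) has_real_derivative
      (of_bool (c = b) * num c ?x0 * Z ?x0 - num c ?x0 * num b ?x0) / (Z ?x0 * Z ?x0)) (at ?x0)"
    using Z by (intro DERIV_divide num) auto
  moreover have pmf: "pmf (softmax_policy G (\<theta>((i, s, p, b) := x)) i s p) d = num d x / Z x"
    if "d \<in> actions G i" for d x
    unfolding pmf_softmax_policy[OF game i] num_def Z_def using that by simp
  moreover have "(of_bool (c = b) * num c ?x0 * Z ?x0 - num c ?x0 * num b ?x0) / (Z ?x0 * Z ?x0) =
      pmf (softmax_policy G \<theta> i s p) c * (of_bool (c = b) - pmf (softmax_policy G \<theta> i s p) b)"
    using Z pmf[OF b, of ?x0] pmf[OF c, of ?x0] by (simp add: field_simps)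
  ultimately show ?thesis
    using c by simp
qed

lemma joint_policy_softmax_bn_policy:
  assumes "is_markov_game G" "is_dag (agents G) E"
  shows "joint_policy G (softmax_bn_policy G E \<theta>)"
  by (auto simp: joint_policy_def set_pmf_iff pmf_softmax_bn_policy[OF assms] split: if_splits)

text \<open>The parameter enters only the factor of agent \<open>i\<close>, and only at state
  \<open>s\<close> with parent action \<open>p\<close>; the product \<open>R\<close> of the other
  factors is constant.\<close>

lemma has_derivative_softmax_bn_policy:
  assumes game: "is_markov_game G" and dag: "is_dag (agents G) E"
    and i: "i \<in> agents G" and b: "b \<in> actions G i" and a: "a \<in> joint_actions G (agents G)"
  shows "((\<lambda>x. pmf (softmax_bn_policy G E (\<theta>((i, s, p, b) := x)) s') a) has_real_derivative
    (if s' = s \<and> restrict a (parents E i) = p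
     then pmf (softmax_bn_policy G E \<theta> s) a * (of_bool (a i = b) - pmf (softmax_policy G \<theta> i s p) b)
     else 0)) (at (\<theta> (i, s, p, b)))"
proof -
  let ?\<theta> = "\<lambda>x. \<theta>((i, s, p, b) := x)"
  define R where "R = (\<Prod>k\<in>agents G - {i}. pmf (softmax_policy G \<theta> k s' (restrict a (parents E k))) (a k))"
  have fin: "finite (agents G)" by (simp add: agents_def)
  have split: "pmf (softmax_bn_policy G E \<theta>' s') a =
      pmf (softmax_policy G \<theta>' i s' (restrict a (parents E i))) (a i) *
      (\<Prod>k\<in>agents G - {i}. pmf (softmax_policy G \<theta>' k s' (restrict a (parents E k))) (a k))" for \<theta>'
    using a prod.remove[OF fin i] by (simp add: pmf_softmax_bn_policy[OF game dag])
  have upd: "pmf (softmax_bn_policy G E (?\<theta> x) s') a =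
      pmf (softmax_policy G (?\<theta> x) i s' (restrict a (parents E i))) (a i) * R" for x
    unfolding split R_def by (simp add: softmax_policy_update_other)
  have ai: "a i \<in> actions G i" using a i by auto
  show ?thesis
  proof (cases "s' = s \<and> restrict a (parents E i) = p")
    case True
    then have s': "s' = s" and p: "restrict a (parents E i) = p" by auto
    have "pmf (softmax_bn_policy G E \<theta> s') a = pmf (softmax_policy G \<theta> i s p) (a i) * R"
      unfolding split R_def by (simp add: s' p)
    then show ?thesis
      using DERIV_cmult_right[OF has_derivative_softmax_policy[OF game i b ai, of \<theta> s p], of R]
      unfolding upd by (simp add: s' p mult.assoc mult.commute[of R])
  next
    case False
    then have "softmax_policy G (?\<theta> x) i s' (restrict a (parents E i)) =
        softmax_policy G \<theta> i s' (restrict a (parents E i))" for x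
      by (intro softmax_policy_update_other) auto
    then show ?thesis using False unfolding upd by auto
  qed
qed

theorem lemma5p1:
  fixes G :: "('s::finite, 'a) markov_game"
    and E :: "(nat \<times> nat) set"
    and \<theta> :: "('s, 'a) params"
    and i :: nat and s :: 's and p :: "nat \<Rightarrow> 'a" and b :: 'a
  assumes "is_markov_game G"
    and "is_dag (agents G) E"
    and "i \<in> agents G"
    and "p \<in> joint_actions G (parents E i)"
    and "b \<in> actions G i"
  shows "((\<lambda>x. game_value G (softmax_bn_policy G E (\<theta>((i, s, p, b) := x))))
           has_real_derivative
             1 / (1 - discount G)
             * partial_visitation_distr G (softmax_bn_policy G E \<theta>) (parents E i) s p
             * pmf (softmax_policy G \<theta> i s p) b
             * local_advantage G E (softmax_bn_policy G E \<theta>) i s p b)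
         (at (\<theta> (i, s, p, b)))"
proof -
  note game = assms(1) and dag = assms(2) and i = assms(3) and p = assms(4) and b = assms(5)
  let ?A = "joint_actions G (agents G)" and ?x0 = "\<theta> (i, s, p, b)" and ?P = "parents E i"
  let ?\<pi>x = "\<lambda>x. softmax_bn_policy G E (\<theta>((i, s, p, b) := x))"
  define \<pi> where "\<pi> = softmax_bn_policy G E \<theta>"
  define w where "w = pmf (softmax_policy G \<theta> i s p) b"
  \<comment> \<open>\<open>S\<close> is the fibre over the parent action \<open>p\<close>, and
    \<open>Sb\<close> turns out to be the fibre over \<open>p(i := b)\<close>.\<close>
  define S where "S = {a \<in> ?A. restrict a ?P = p}"
  define Sb where "Sb = {a \<in> S. a i = b}"
  define Q where "Q = action_value G \<pi> s"
  define D where "D s' a = (if s' = s \<and> restrict a ?P = p then pmf (\<pi> s) a * (of_bool (a i = b) - w) else 0)" for s' a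
  have finA: "finite ?A" by (rule finite_joint_actions[OF game])
  then have finS: "finite S" by (simp add: S_def)
  have x0: "?\<pi>x ?x0 = \<pi>" by (simp add: \<pi>_def)
  \<comment> \<open>A loop at \<open>i\<close> would be a cycle.\<close>
  have P: "?P \<subseteq> agents G" and iP: "i \<notin> ?P"
    using dag by (auto simp: is_dag_def parents_def acyclic_def)
  have joint: "joint_policy G (?\<pi>x x)" for x
    by (rule joint_policy_softmax_bn_policy[OF game dag])
  have deriv: "((\<lambda>x. pmf (?\<pi>x x s') a) has_real_derivative D s' a) (at ?x0)" if "a \<in> ?A" for s' a
    unfolding D_def w_def \<pi>_def by (rule has_derivative_softmax_bn_policy[OF game dag i b that])
  \<comment> \<open>Used twice: with \<open>f\<close> constant 1 for the mass identity and with
    \<open>Q\<close> for the gradient.\<close>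
  have sum_D: "(\<Sum>a\<in>?A. D s a * f a) = (\<Sum>a\<in>Sb. pmf (\<pi> s) a * f a) - w * (\<Sum>a\<in>S. pmf (\<pi> s) a * f a)" for f
  proof -
    have "(\<Sum>a\<in>?A. D s a * f a) = (\<Sum>a\<in>S. (if a i = b then pmf (\<pi> s) a * f a else 0) - w * (pmf (\<pi> s) a * f a))"
      using finA unfolding S_def by (subst sum.inter_filter) (auto simp: D_def algebra_simps intro!: sum.cong)
    also have "\<dots> = (\<Sum>a\<in>Sb. pmf (\<pi> s) a * f a) - w * (\<Sum>a\<in>S. pmf (\<pi> s) a * f a)"
      unfolding Sb_def using finS by (subst sum.inter_filter) (auto simp: sum_subtractf sum_distrib_left)
    finally show ?thesis .
  qed
  \<comment> \<open>Bayesian network factorization of the marginal on \<open>i\<close> and its parents: differentiate the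
    total mass \<open>1\<close> of the policy.\<close>
  have mass: "(\<Sum>a\<in>Sb. pmf (\<pi> s) a) = w * (\<Sum>a\<in>S. pmf (\<pi> s) a)"
  proof -
    have "((\<lambda>x. \<Sum>a\<in>?A. pmf (?\<pi>x x s) a) has_real_derivative (\<Sum>a\<in>?A. D s a)) (at ?x0)"
      by (intro derivative_intros deriv)
    moreover have "(\<Sum>a\<in>?A. pmf (?\<pi>x x s) a) = 1" for x
      using joint[of x] finA by (intro sum_pmf_eq_1) (auto simp: joint_policy_def)
    ultimately have "((\<lambda>_. 1) has_real_derivative (\<Sum>a\<in>?A. D s a)) (at ?x0)"
      by simp
    then have "(\<Sum>a\<in>?A. D s a) = 0"
      by (rule DERIV_unique) (rule DERIV_const)
    then show ?thesis using sum_D[of "\<lambda>_. 1"] by simp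
  qed
  have S_pos: "(\<Sum>a\<in>S. pmf (\<pi> s) a) > 0"
  proof (rule sum_pos[OF finS])
    have "?A \<noteq> {}" using game by (auto simp: PiE_eq_empty_iff is_markov_game_def)
    then obtain a where "a \<in> ?A" by auto
    \<comment> \<open>Witness: any joint action, overwritten by \<open>p\<close> on the
      parents.\<close>
    then have "merge ?P (agents G - ?P) (p, a) \<in> S"
      using p P by (auto simp: S_def merge_def fun_eq_iff PiE_iff extensional_def)
    then show "S \<noteq> {}" by auto
    show "pmf (\<pi> s) a > 0" if "a \<in> S" for a
      using that unfolding \<pi>_def S_def
      by (auto simp: pmf_softmax_bn_policy[OF game dag] intro!: prod_pos pmf_softmax_policy_pos[OF game])
  qed
  have w_pos: "w > 0" unfolding w_def by (rule pmf_softmax_policy_pos[OF game i b])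
  have Sb: "{a \<in> ?A. restrict a (insert i ?P) = p(i := b)} = Sb"
  proof -
    have "restrict a (insert i ?P) = p(i := b) \<longleftrightarrow> restrict a ?P = p \<and> a i = b" for a
    proof -
      have "restrict a (insert i ?P) = (restrict a ?P)(i := a i)"
        by (auto simp: restrict_def fun_eq_iff)
      \<comment> \<open>Both are \<open>undefined\<close>, since \<open>i\<close> is not its own
        parent; so equal updates at \<open>i\<close> come from equal functions.\<close>
      moreover have "restrict a ?P i = p i"
        using iP p by (auto simp: PiE_iff extensional_def)
      ultimately show ?thesis
        by (metis fun_upd_eqD fun_upd_triv fun_upd_upd)
    qed
    then show ?thesis by (auto simp only: S_def Sb_def mem_Collect_eq)
  qed
  have pb: "p(i := b) \<in> joint_actions G (insert i ?P)"
    using p b by (auto simp: PiE_iff extensional_def)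
  have adv: "local_advantage G E \<pi> i s p b =
      (\<Sum>a\<in>Sb. pmf (\<pi> s) a * Q a) / (\<Sum>a\<in>Sb. pmf (\<pi> s) a) - (\<Sum>a\<in>S. pmf (\<pi> s) a * Q a) / (\<Sum>a\<in>S. pmf (\<pi> s) a)"
    using P i p pb by (simp add: local_advantage_def partial_action_value_eq Sb Q_def S_def)
  \<comment> \<open>The prefactor cancels the normalization in
    \<open>visitation_distr\<close>.\<close>
  have vis: "1 / (1 - discount G) * partial_visitation_distr G \<pi> ?P s p = visitation G \<pi> s * (\<Sum>a\<in>S. pmf (\<pi> s) a)"
    using discount_bounds(2)[OF game] by (simp add: partial_visitation_distr_eq[OF P p] visitation_distr_def S_def)
  have "((\<lambda>x. game_value G (?\<pi>x x)) has_real_derivative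
      (\<Sum>s'\<in>UNIV. visitation G \<pi> s' * (\<Sum>a\<in>?A. D s' a * action_value G \<pi> s' a))) (at ?x0)"
    using policy_gradient[where \<pi>="?\<pi>x", OF game joint deriv] unfolding x0 .
  \<comment> \<open>\<open>D\<close> vanishes at all states other than \<open>s\<close>.\<close>
  also have "(\<Sum>s'\<in>UNIV. visitation G \<pi> s' * (\<Sum>a\<in>?A. D s' a * action_value G \<pi> s' a)) =
      visitation G \<pi> s * (\<Sum>a\<in>?A. D s a * Q a)"
    by (subst sum.remove[of _ s]) (auto simp: D_def Q_def intro!: sum.neutral)
  \<comment> \<open>By \<open>mass\<close> the two denominators of the advantage differ by the
    factor \<open>w\<close>; clearing them gives both terms of \<open>sum_D\<close>.\<close>
  also have "\<dots> = visitation G \<pi> s * (\<Sum>a\<in>S. pmf (\<pi> s) a) * w * local_advantage G E \<pi> i s p b"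
    unfolding sum_D adv mass using S_pos w_pos by (simp add: field_simps)
  finally show ?thesis
    unfolding vis[symmetric] unfolding w_def \<pi>_def .
qed

end
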